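(* If $G$ is a connected, nontraceable detour graph, then $\tau(G)\ge 9$. (In particular such a graph has at least $10$ vertices.)
   Context: All graphs are finite and simple. The order of a path is its number of vertices. For a vertex $v$ of $G$, $\tau(v)$ is the order of a longest path in $G$ having $v$ as an endvertex, and $\tau(G)$ is the order of a longest path in $G$. A graph is nontraceable if it has no path containing all its vertices. A detour graph is a graph in which all vertices have the same value of $\tau(v)$. *)

theory Defs
  imports Main
begin

definition simple_graph :: "'a set \<Rightarrow> ('a \<Rightarrow> 'a \<Rightarrow> bool) \<Rightarrow> bool" where
  "simple_graph V E \<longleftrightarrow> finite V \<and> (\<forall>x y. E x y \<longrightarrow> x \<in> V \<and> y \<in> V)
     \<and> (\<forall>x. \<not> E x x) \<and> (\<forall>x y. E x y \<longrightarrow> E y x)"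

definition is_path :: "'a set \<Rightarrow> ('a \<Rightarrow> 'a \<Rightarrow> bool) \<Rightarrow> 'a list \<Rightarrow> bool" where
  "is_path V E p \<longleftrightarrow> p \<noteq> [] \<and> distinct p \<and> set p \<subseteq> V
     \<and> (\<forall>i. Suc i < length p \<longrightarrow> E (p ! i) (p ! Suc i))"

definition connected_graph :: "'a set \<Rightarrow> ('a \<Rightarrow> 'a \<Rightarrow> bool) \<Rightarrow> bool" where
  "connected_graph V E \<longleftrightarrow> V \<noteq> {} \<and>
     (\<forall>u\<in>V. \<forall>v\<in>V. \<exists>p. is_path V E p \<and> hd p = u \<and> last p = v)"

definition tau_graph :: "'a set \<Rightarrow> ('a \<Rightarrow> 'a \<Rightarrow> bool) \<Rightarrow> nat" where
  "tau_graph V E = Max (length ` {p. is_path V E p})"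

definition tau_vertex :: "'a set \<Rightarrow> ('a \<Rightarrow> 'a \<Rightarrow> bool) \<Rightarrow> 'a \<Rightarrow> nat" where
  "tau_vertex V E v = Max (length ` {p. is_path V E p \<and> (hd p = v \<or> last p = v)})"

definition traceable :: "'a set \<Rightarrow> ('a \<Rightarrow> 'a \<Rightarrow> bool) \<Rightarrow> bool" where
  "traceable V E \<longleftrightarrow> (\<exists>p. is_path V E p \<and> set p = V)"

definition detour_graph :: "'a set \<Rightarrow> ('a \<Rightarrow> 'a \<Rightarrow> bool) \<Rightarrow> bool" where
  "detour_graph V E \<longleftrightarrow> (\<forall>u\<in>V. \<forall>v\<in>V. tau_vertex V E u = tau_vertex V E v)"

end

theory Submission
  imports Defs
begin

text \<open>
  Every vertex \<open>v\<close> starts a path of maximal order \<open>t\<close>, and this path must contain all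
  neighbours of \<open>v\<close>. Applied to a vertex of a cut set, this gives that \<open>G\<close> has no cut
  vertex, that deleting two vertices leaves at most two components, and that \<open>t\<close> is small
  if deleting a set \<open>S\<close> leaves an almost independent set. Moreover no \<open>t\<close> vertices carry a
  spanning cycle. Let \<open>t \<le> 8\<close> and let \<open>v\<^sub>1, \<dots>, v\<^sub>t\<close> be a path with \<open>v\<^sub>1 \<sim> v\<^sub>i\<close> and
  \<open>v\<^sub>t \<sim> v\<^sub>j\<close>. If \<open>j < i\<close>, then the path spans a theta graph whose three
  branches have at most 6 inner vertices together, and the few possible shapes are excluded by
  these facts. So always \<open>i \<le> j\<close>; taking \<open>j - i\<close> minimal, at one end of the path at most
  three vertices lie beyond \<open>v\<^sub>j\<close> (or before \<open>v\<^sub>i\<close>), and minimality confines the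
  neighbours of the possible end vertices there, which yields a forbidden cut of size 1 or 2.
\<close>

section \<open>Cuts and longest paths\<close>

text \<open>Connectivity takes the form \<open>conn\<close>: a nonempty set of vertices that no edge
  leaves is all of \<open>V\<close>. In \<open>starts\<close> the vertex always comes first, since
  paths can be reversed; together with \<open>longest\<close> this says that \<open>t\<close> is the
  common detour order.\<close>

locale detour =
  fixes V :: "'a set" and E :: "'a \<Rightarrow> 'a \<Rightarrow> bool" and t :: nat
  assumes fin: "finite V"
    and E_in: "E a b \<Longrightarrow> a \<in> V" "E a b \<Longrightarrow> b \<in> V"
    and irrefl: "\<not> E a a"
    and sym: "E a b \<Longrightarrow> E b a"
    and longest: "distinct p \<Longrightarrow> successively E p \<Longrightarrow> set p \<subseteq> V \<Longrightarrow> length p \<le> t"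
    and starts: "v \<in> V \<Longrightarrow> \<exists>p. distinct p \<and> successively E p \<and> set p \<subseteq> V \<and> length p = t \<and> p \<noteq> [] \<and> hd p = v"
    and conn: "D \<subseteq> V \<Longrightarrow> D \<noteq> {} \<Longrightarrow> (\<And>d w. d \<in> D \<Longrightarrow> E d w \<Longrightarrow> w \<in> D) \<Longrightarrow> D = V"
    and nontraceable: "distinct p \<Longrightarrow> successively E p \<Longrightarrow> set p \<noteq> V"
    and nonempty: "V \<noteq> {}"
begin

text \<open>Unlike \<open>is_path\<close>, this admits the empty list.\<close>

definition path :: "'a list \<Rightarrow> bool" where
  "path p \<longleftrightarrow> distinct p \<and> successively E p \<and> set p \<subseteq> V"

text \<open>\<open>D\<close> is a possibly empty union of components of the graph with
  \<open>S\<close> deleted.\<close>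

definition closed_mod :: "'a set \<Rightarrow> 'a set \<Rightarrow> bool" where
  "closed_mod S D \<longleftrightarrow> D \<subseteq> V \<and> D \<inter> S = {} \<and> (\<forall>d\<in>D. \<forall>w. E d w \<longrightarrow> w \<in> D \<union> S)"

lemma E_commute: "E a b \<longleftrightarrow> E b a"
  using sym by blast

lemma E_flip: "(\<lambda>a b. E b a) = E"
  using E_commute by blast

lemma successively_E_flip: "successively (\<lambda>a b. E b a) p \<longleftrightarrow> successively E p"
  by (rule arg_cong2[OF E_flip refl])

lemma path_rev: "path (rev p) \<longleftrightarrow> path p"
  by (simp add: path_def successively_E_flip)

lemma path_length: "path p \<Longrightarrow> length p \<le> t"
  using longest by (simp add: path_def)

lemma hd_nbr:
  assumes "path p" "length p = t" "p \<noteq> []" "E (hd p) z"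
  shows "z \<in> set p"
proof (rule ccontr)
  assume "z \<notin> set p"
  then have "path (z # p)"
    using assms E_in(2)[OF assms(4)] sym[OF assms(4)] by (auto simp: path_def successively_Cons)
  then show False using path_length assms(2) by fastforce
qed

lemma last_nbr:
  assumes "path p" "length p = t" "p \<noteq> []" "E (last p) z"
  shows "z \<in> set p"
  using hd_nbr[of "rev p" z] assms by (simp add: path_rev hd_rev)

lemma outside:
  assumes "path p" shows "\<exists>z\<in>V. z \<notin> set p"
  using assms nontraceable unfolding path_def by blast

text \<open>A cycle on \<open>t\<close> vertices misses a vertex, so by connectivity an edge
  \<open>d w\<close> leaves it. Opening the cycle at \<open>d\<close> and putting \<open>w\<close>
  in front gives a path that is too long.\<close>

lemma no_cycle:
  assumes "path p" "length p = t" "p \<noteq> []"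
  shows "\<not> E (last p) (hd p)"
proof
  assume e: "E (last p) (hd p)"
  have "set p \<subseteq> V" "set p \<noteq> V" "set p \<noteq> {}"
    using assms outside by (auto simp: path_def)
  then obtain d w where dw: "d \<in> set p" "E d w" "w \<notin> set p"
    using conn[of "set p"] by blast
  then obtain as bs where p: "p = as @ d # bs" by (auto simp: in_set_conv_decomp)
  have "path (w # d # bs @ as)"
    using assms(1) dw e sym[OF dw(2)] E_in(2)[OF dw(2)]
    by (cases as; cases bs rule: rev_cases)
      (auto simp: p path_def successively_append_iff successively_Cons hd_append split: if_splits)
  then show False using path_length assms(2) p by fastforce
qed

section \<open>Cuts of one and two vertices\<close>

lemma closed_mod_path:
  assumes "closed_mod S D" "successively E p" "set p \<inter> S = {}"
  shows "set p \<subseteq> D \<or> set p \<inter> D = {}"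
  using assms(2,3)
proof (induction p)
  case (Cons a p)
  then have IH: "set p \<subseteq> D \<or> set p \<inter> D = {}" by (auto simp: successively_Cons)
  show ?case
  proof (cases p)
    case (Cons b q)
    then have "E a b" "E b a" "a \<notin> S" "b \<notin> S" using Cons.prems sym by auto
    then have "a \<in> D \<longleftrightarrow> b \<in> D" using assms(1) unfolding closed_mod_def by blast
    then show ?thesis using IH Cons by auto
  qed auto
qed auto

lemma start_path:
  assumes "x \<in> V"
  obtains q where "path (x # q)" "length (x # q) = t" "\<And>z. E x z \<Longrightarrow> z \<in> set q"
proof -
  obtain p where p: "path p" "length p = t" "p \<noteq> []" "hd p = x"
    using starts[OF assms] by (auto simp: path_def)
  show thesis
  proof (cases p)
    case (Cons a q)
    then show ?thesis using that[of q] p hd_nbr[of p] irrefl by (metis list.sel(1) set_ConsD)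
  qed (use p in simp)
qed

text \<open>A longest path starting at \<open>x\<close> contains both \<open>a\<close> and
  \<open>b\<close>, yet after \<open>x\<close> it can no longer pass between \<open>D\<close> and
  its complement.\<close>

lemma no_cut_vertex:
  assumes "closed_mod {x} D" "a \<in> D" "E x a" "E x b" "b \<notin> D"
  shows False
proof -
  obtain q where q: "path (x # q)" "\<And>z. E x z \<Longrightarrow> z \<in> set q"
    using start_path E_in assms(3) by metis
  have "set q \<subseteq> D \<or> set q \<inter> D = {}"
    by (rule closed_mod_path[OF assms(1)]) (use q(1) in \<open>auto simp: path_def successively_Cons\<close>)
  then show False using q(2) assms by blast
qed

lemma closed_mod_nbr:
  assumes "closed_mod {x} D" "D \<noteq> {}" "x \<in> V"
  shows "\<exists>d\<in>D. E x d"
proof (rule ccontr)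
  assume "\<not> ?thesis"
  then have "\<And>d w. d \<in> D \<Longrightarrow> E d w \<Longrightarrow> w \<in> D"
    using assms(1) sym unfolding closed_mod_def by blast
  then have "D = V" using conn[of D] assms(1,2) unfolding closed_mod_def by blast
  then show False using assms(1,3) unfolding closed_mod_def by blast
qed

lemma closed_mod_drop:
  assumes "closed_mod {x, y} D" "\<And>z. E x z \<Longrightarrow> z \<notin> D"
  shows "closed_mod {y} D"
  using assms sym unfolding closed_mod_def by blast

lemma closed_mod_swap: "closed_mod {x, y} D \<longleftrightarrow> closed_mod {y, x} D"
  by (simp add: insert_commute)

text \<open>Otherwise \<open>D\<close> would be attached to \<open>y\<close> alone, and
  \<open>y\<close> would be a cut vertex separating \<open>D\<close> from \<open>b\<close>.\<close>

lemma closed_mod_attached: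
  assumes "closed_mod {x, y} D" "D \<noteq> {}" "y \<in> V" "E y b" "b \<notin> D"
  shows "\<exists>z\<in>D. E x z"
proof (rule ccontr)
  assume "\<not> ?thesis"
  then have c: "closed_mod {y} D" using closed_mod_drop assms(1) by blast
  obtain d where "d \<in> D" "E y d" using closed_mod_nbr[OF c] assms by blast
  then show False using no_cut_vertex[OF c] assms by blast
qed

text \<open>If \<open>x\<close> had no neighbour in \<open>A\<close>, then
  \<open>closed_mod_attached\<close> would force all neighbours of \<open>y\<close> into
  \<open>A\<close>. So \<open>B\<close> and \<open>C\<close> would both be attached to
  \<open>x\<close> alone, making \<open>x\<close> a cut vertex.\<close>

lemma three_parts_attached:
  assumes D: "closed_mod {x, y} A" "closed_mod {x, y} B" "closed_mod {x, y} C"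
    and ne: "A \<noteq> {}" "B \<noteq> {}" "C \<noteq> {}"
    and dis: "A \<inter> B = {}" "A \<inter> C = {}" "B \<inter> C = {}"
    and xy: "x \<in> V" "y \<in> V"
  shows "\<exists>z\<in>A. E x z"
proof (rule ccontr)
  assume "\<not> ?thesis"
  then have Ny: "\<And>b. E y b \<Longrightarrow> b \<in> A" using closed_mod_attached D(1) ne xy by blast
  have B: "closed_mod {x} B" and C: "closed_mod {x} C"
    using closed_mod_drop[of y x] closed_mod_swap D(2,3) Ny dis by blast+
  obtain d e where "d \<in> B" "E x d" "e \<in> C" "E x e"
    using closed_mod_nbr B C ne xy by metis
  then show False using no_cut_vertex[OF B] dis by blast
qed

text \<open>\<open>x\<close> has neighbours in all three parts, and a longest path starting at
  \<open>x\<close> contains them. After \<open>x\<close>, deleting \<open>y\<close> leaves at most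
  two pieces of this path, and each piece meets at most one part.\<close>

lemma no_three_parts:
  assumes xy: "x \<in> V" "y \<in> V"
    and D: "closed_mod {x, y} D1" "closed_mod {x, y} D2" "closed_mod {x, y} D3"
    and ne: "D1 \<noteq> {}" "D2 \<noteq> {}" "D3 \<noteq> {}"
    and dis: "D1 \<inter> D2 = {}" "D1 \<inter> D3 = {}" "D2 \<inter> D3 = {}"
  shows False
proof -
  obtain q where q: "path (x # q)" "\<And>z. E x z \<Longrightarrow> z \<in> set q"
    using start_path xy by metis
  have y: "y \<notin> D1" "y \<notin> D2" "y \<notin> D3" using D by (auto simp: closed_mod_def)
  have "\<exists>z\<in>D1. E x z" "\<exists>z\<in>D2. E x z" "\<exists>z\<in>D3. E x z"
    using three_parts_attached[OF D ne dis xy] three_parts_attached[of x y D2 D1 D3]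
      three_parts_attached[of x y D3 D1 D2] D ne dis xy by (simp_all add: Int_commute)
  then have nb: "\<exists>z\<in>D1. z \<in> set q - {y}" "\<exists>z\<in>D2. z \<in> set q - {y}" "\<exists>z\<in>D3. z \<in> set q - {y}"
    using q(2) y by blast+
  obtain q1 q2 where q12: "set q - {y} \<subseteq> set q1 \<union> set q2" "successively E q1" "successively E q2"
    "set q1 \<inter> {x, y} = {}" "set q2 \<inter> {x, y} = {}"
  proof (cases "y \<in> set q")
    case True
    then obtain q1 q2 where "q = q1 @ y # q2" by (auto simp: in_set_conv_decomp)
    then show ?thesis using that[of q1 q2] q(1)
      by (auto simp: path_def successively_append_iff successively_Cons)
  next
    case False
    then show ?thesis using that[of q "[]"] q(1) by (auto simp: path_def successively_Cons)
  qed
  have comp: "set q' \<subseteq> D \<or> set q' \<inter> D = {}" if "closed_mod {x, y} D" "q' \<in> {q1, q2}" for q' D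
    using closed_mod_path[OF that(1), of q'] that(2) q12 by blast
  have excl: "set q' \<inter> A = {} \<or> set q' \<inter> B = {}"
    if "closed_mod {x, y} A" "closed_mod {x, y} B" "A \<inter> B = {}" "q' \<in> {q1, q2}" for q' A B
    using comp[OF that(1,4)] comp[OF that(2,4)] that(3) by blast
  have meet: "set q1 \<inter> A \<noteq> {} \<or> set q2 \<inter> A \<noteq> {}" if "\<exists>z\<in>A. z \<in> set q - {y}" for A
    using that q12(1) by blast
  show False
    using excl[OF D(1,2) dis(1)] excl[OF D(1,3) dis(2)] excl[OF D(2,3) dis(3)]
      meet[OF nb(1)] meet[OF nb(2)] meet[OF nb(3)] by (meson insertI1 insertI2)
qed

text \<open>The case \<open>R = {}\<close> says that \<open>V - S\<close> is independent; the set \<open>R\<close> allows for a few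
  components of order 2.\<close>

lemma almost_independent_path_length:
  assumes "\<And>a b. E a b \<Longrightarrow> a \<in> S \<or> b \<in> S \<or> a \<in> R \<or> b \<in> R"
    and "\<And>a b c. E a b \<Longrightarrow> E b c \<Longrightarrow> a \<noteq> c \<Longrightarrow> a \<in> S \<or> b \<in> S \<or> c \<in> S"
  shows "distinct (a # p) \<Longrightarrow> successively E (a # p) \<Longrightarrow> a \<in> S \<Longrightarrow>
    length (a # p) \<le> 2 * card (set (a # p) \<inter> S) + card (set (a # p) \<inter> R)"
\<comment> \<open>The path is peeled from one vertex of \<open>S\<close> to the next, with at most
  two vertices in between. A vertex of \<open>S\<close> pays for itself and one vertex after it; if
  two vertices \<open>b\<close>, \<open>c\<close> follow outside \<open>S\<close>, one of them is in
  \<open>R\<close> and pays for the second.\<close>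
proof (induction "length p" arbitrary: a p rule: less_induct)
  case less
  have cS: "card (set (a # q) \<inter> S) = Suc (card (set q \<inter> S))" if "a \<notin> set q" for q
    using that less.prems(3) by (simp add: Int_insert_left)
  have cR: "card (set (a # q) \<inter> R) \<ge> card (set q \<inter> R)" for q
    by (rule card_mono) auto
  show ?case
  proof (cases p)
    case Nil
    then show ?thesis using cS[of "[]"] by simp
  next
    case (Cons b q)
    show ?thesis
    proof (cases "b \<in> S")
      case True
      then show ?thesis using less.hyps[of q b] less.prems cS[of p] cR[of p] Cons by simp
    next
      case bS: False
      show ?thesis
      proof (cases q)
        case Nil
        then show ?thesis using cS[of p] Cons less.prems by simp
      next
        case q: (Cons c r)
        have bc: "E b c" using less.prems Cons q by simp
        have mR: "card (set (b # q) \<inter> R) \<ge> card (set q \<inter> R)" by (rule card_mono) auto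
        show ?thesis
        proof (cases "c \<in> S")
          case True
          then show ?thesis using less.hyps[of r c] less.prems cS[of p] cR[of p] mR Cons q bS by simp
        next
          case cS': False
          have bcR: "b \<in> R \<or> c \<in> R" using assms(1)[OF bc] bS cS' by blast
          have br: "b \<notin> set r" "c \<notin> set r" using less.prems Cons q by auto
          have "card (set p \<inter> R) \<ge> Suc (card (set r \<inter> R))"
          proof -
            have "set r \<inter> R \<subset> set p \<inter> R" using bcR br Cons q by auto
            then show ?thesis by (simp add: psubset_card_mono Suc_leI)
          qed
          then have R1: "card (set (a # p) \<inter> R) \<ge> Suc (card (set r \<inter> R))" using cR[of p] by simp
          show ?thesis
          proof (cases r)
            case Nil
            then show ?thesis using R1 cS[of p] Cons q less.prems by simp
          next
            case r: (Cons d s)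
            have "E c d" "b \<noteq> d" using less.prems Cons q r by auto
            then have "d \<in> S" using assms(2)[OF bc] bS cS' by blast
            then show ?thesis using less.hyps[of s d] less.prems cS[of p] R1 Cons q r bS cS' by simp
          qed
        qed
      qed
    qed
  qed
qed

text \<open>The detour property lets a longest path start in \<open>S\<close>; a path starting
  elsewhere could exceed the bound by one, already when \<open>R\<close> is empty.\<close>

lemma almost_independent_bound:
  assumes S: "x \<in> S" "x \<in> V" "finite S" "finite R"
    and "\<And>a b. E a b \<Longrightarrow> a \<in> S \<or> b \<in> S \<or> a \<in> R \<or> b \<in> R"
    and "\<And>a b c. E a b \<Longrightarrow> E b c \<Longrightarrow> a \<noteq> c \<Longrightarrow> a \<in> S \<or> b \<in> S \<or> c \<in> S"
  shows "t \<le> 2 * card S + card R"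
proof -
  obtain q where q: "path (x # q)" "length (x # q) = t" using start_path S(2) by metis
  have "length (x # q) \<le> 2 * card (set (x # q) \<inter> S) + card (set (x # q) \<inter> R)"
    using q(1) S(1) assms(5,6) by (intro almost_independent_path_length) (auto simp: path_def)
  also have "\<dots> \<le> 2 * card S + card R"
    using S by (intro add_mono mult_left_mono card_mono) auto
  finally show ?thesis using q by simp
qed

section \<open>Theta graphs on \<open>t\<close> vertices\<close>

text \<open>\<open>A\<close>, \<open>B\<close>, \<open>C\<close> list the inner vertices of the three branches, each from \<open>x\<close> to \<open>y\<close>.\<close>

definition theta :: "'a \<Rightarrow> 'a \<Rightarrow> 'a list \<Rightarrow> 'a list \<Rightarrow> 'a list \<Rightarrow> bool" where
  "theta x y A B C \<longleftrightarrow> A \<noteq> [] \<and> B \<noteq> [] \<and> C \<noteq> [] \<and> distinct (x # y # A @ B @ C) \<and>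
     successively E (x # A @ [y]) \<and> successively E (x # B @ [y]) \<and> successively E (x # C @ [y]) \<and>
     length A + length B + length C + 2 = t"

definition theta_verts :: "'a \<Rightarrow> 'a \<Rightarrow> 'a list \<Rightarrow> 'a list \<Rightarrow> 'a list \<Rightarrow> 'a set" where
  "theta_verts x y A B C = {x, y} \<union> set A \<union> set B \<union> set C"

lemma successively_subset:
  assumes "successively E p" "length p \<ge> 2" shows "set p \<subseteq> V"
  using assms
proof (induction p)
  case (Cons a p)
  then show ?case
    by (cases p; cases "tl p") (auto dest: E_in)
qed simp

lemma theta_iff:
  "theta x y A B C \<longleftrightarrow> A \<noteq> [] \<and> B \<noteq> [] \<and> C \<noteq> [] \<and> distinct (x # y # A @ B @ C) \<and>
     successively E A \<and> successively E B \<and> successively E C \<and>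
     E x (hd A) \<and> E x (hd B) \<and> E x (hd C) \<and> E (last A) y \<and> E (last B) y \<and> E (last C) y \<and>
     length A + length B + length C + 2 = t"
  by (auto simp: theta_def successively_append_iff successively_Cons)

lemma theta_swap12: "theta x y A B C \<Longrightarrow> theta x y B A C"
  by (auto simp: theta_iff)

lemma theta_swap23: "theta x y A B C \<Longrightarrow> theta x y A C B"
  by (auto simp: theta_iff)

lemma theta_rev: "theta x y A B C \<Longrightarrow> theta y x (rev A) (rev B) (rev C)"
  by (auto simp: theta_iff successively_E_flip hd_rev last_rev E_commute)

lemma theta_verts_V: "theta x y A B C \<Longrightarrow> theta_verts x y A B C \<subseteq> V"
  unfolding theta_def theta_verts_def
  using successively_subset[of "x # A @ [y]"] successively_subset[of "x # B @ [y]"]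
    successively_subset[of "x # C @ [y]"] by auto

text \<open>Running through \<open>A\<close> to \<open>y\<close>, back along \<open>B\<close> to
  \<open>x\<close> and then through \<open>C\<close> covers all \<open>t\<close> vertices. Hence
  \<open>hd A\<close> and \<open>last C\<close> are ends of a longest path, to which
  \<open>hd_nbr\<close> and \<open>no_cycle\<close> apply; symmetry extends this to all
  branches.\<close>

lemma theta_path:
  assumes "theta x y A B C"
  shows "path (A @ y # rev B @ x # C)"
  using assms theta_verts_V[OF assms]
  by (auto simp: theta_iff theta_verts_def path_def successively_append_iff successively_Cons
      successively_E_flip hd_rev last_rev hd_append E_commute)

lemma theta_outside:
  assumes "theta x y A B C" shows "\<exists>z\<in>V. z \<notin> theta_verts x y A B C"
  using outside[OF theta_path[OF assms]] by (auto simp: theta_verts_def)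

lemma theta_hd_nbr:
  assumes "theta x y A B C" "E (hd A) z" shows "z \<in> theta_verts x y A B C"
  using hd_nbr[OF theta_path[OF assms(1)], of z] assms by (auto simp: theta_iff theta_verts_def)

lemma theta_last_nbr:
  assumes "theta x y A B C" "E (last A) z" shows "z \<in> theta_verts x y A B C"
  using theta_hd_nbr[OF theta_rev[OF assms(1)], of z] assms(2)
  by (auto simp: theta_verts_def hd_rev)

lemma theta_not_last_hd:
  assumes "theta x y A B C" shows "\<not> E (last C) (hd A)"
  using no_cycle[OF theta_path[OF assms(1)]] assms by (auto simp: theta_iff)

text \<open>From \<open>z\<close> to \<open>x\<close>, through \<open>C\<close> to \<open>y\<close>,
  back along \<open>A\<close> and over the assumed edge into \<open>B\<close> would be a path on
  \<open>t + 1\<close> vertices.\<close>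

lemma theta_not_hd_hd:
  assumes th: "theta x y A B C" and z: "E x z" "z \<notin> theta_verts x y A B C"
  shows "\<not> E (hd A) (hd B)"
proof
  assume e: "E (hd A) (hd B)"
  have "path (z # x # C @ y # rev A @ B)"
    using th theta_verts_V[OF th] z e sym[OF z(1)] E_in(2)[OF z(1)]
    by (auto simp: theta_iff theta_verts_def path_def successively_append_iff successively_Cons
      successively_E_flip hd_rev last_rev hd_append E_commute)
  then show False using path_length th by (fastforce simp: theta_iff)
qed

text \<open>A path entering by \<open>z'\<close>, \<open>z\<close> at \<open>x\<close> and running
  through \<open>A\<close>, \<open>y\<close> and \<open>B\<close> gains two vertices and loses only
  the one of \<open>C\<close>.\<close>

lemma theta_outside_isolated:
  assumes th: "theta x y A B C" "length C = 1"
    and z: "E x z" "z \<notin> theta_verts x y A B C" "E z z'"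
  shows "z' \<in> theta_verts x y A B C"
proof (rule ccontr)
  assume n: "z' \<notin> theta_verts x y A B C"
  have "path (z' # z # x # A @ y # rev B)"
    using th theta_verts_V[OF th(1)] z n sym[OF z(1)] sym[OF z(3)] E_in[OF z(3)] irrefl[of z]
    by (auto simp: theta_iff theta_verts_def path_def successively_append_iff successively_Cons
      successively_E_flip hd_rev last_rev hd_append E_commute)
  then show False using path_length th by (fastforce simp: theta_iff)
qed

text \<open>\<open>u\<close> is both first and last on its branch, so
  \<open>theta_not_last_hd\<close> excludes both ends of each other branch.\<close>

lemma theta_single_nbr:
  assumes th: "theta x y [u] B C" and e: "E u z"
  shows "z \<in> {x, y} \<union> (set B - {hd B, last B}) \<union> (set C - {hd C, last C})"
proof -
  have "z \<in> theta_verts x y [u] B C" using theta_hd_nbr[OF th] e by simp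
  moreover have "\<not> E (last C) u" using theta_not_last_hd[OF th] by simp
  moreover have "\<not> E (last B) u" using theta_not_last_hd[OF theta_swap23[OF th]] by simp
  moreover have "\<not> E u (hd B)"
    using theta_not_last_hd[OF theta_swap23[OF theta_swap12[OF th]]] by simp
  moreover have "\<not> E u (hd C)"
    using theta_not_last_hd[OF theta_swap23[OF theta_swap12[OF theta_swap23[OF th]]]] by simp
  ultimately show ?thesis using e sym irrefl unfolding theta_verts_def by auto
qed

section \<open>Vertices outside the theta graph\<close>

lemma theta_outside_closed:
  assumes "\<And>c z. c \<in> theta_verts x y A B C - S \<Longrightarrow> E c z \<Longrightarrow> z \<in> theta_verts x y A B C"
    and "S \<subseteq> theta_verts x y A B C"
  shows "closed_mod S (V - theta_verts x y A B C)"
  unfolding closed_mod_def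
proof (intro conjI ballI allI impI)
  fix d w assume "d \<in> V - theta_verts x y A B C" "E d w"
  then show "w \<in> V - theta_verts x y A B C \<union> S"
    using assms(1)[of w d] sym E_in by blast
qed (use assms(2) in auto)

text \<open>An edge outside \<open>W\<close> would put \<open>z\<close> into the set
  \<open>D\<close> of vertices with no neighbour in \<open>W\<close>. No edge leaves
  \<open>D\<close>, so it would be all of \<open>V\<close>, although it misses
  \<open>W\<close>.\<close>

lemma outside_independent:
  assumes "W \<subseteq> V" "W \<noteq> {}"
    and iso: "\<And>s z z'. s \<in> W \<Longrightarrow> E s z \<Longrightarrow> z \<notin> W \<Longrightarrow> E z z' \<Longrightarrow> z' \<in> W"
    and "E z z'"
  shows "z \<in> W \<or> z' \<in> W"
proof (rule ccontr)
  assume n: "\<not> ?thesis"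
  define D where "D = {d \<in> V - W. \<forall>s\<in>W. \<not> E s d}"
  have "z \<in> D" using n iso[of _ z z'] assms(4) E_in(1) unfolding D_def by blast
  moreover have "w \<in> D" if "d \<in> D" "E d w" for d w
    using that iso[of _ w d] sym E_in(2) unfolding D_def by blast
  ultimately have "D = V" using conn[of D] unfolding D_def by blast
  then show False using assms(1,2) unfolding D_def by blast
qed

text \<open>This reduces \<open>almost_independent_bound\<close> to checks around the theta graph.
  As \<open>r\<close> and \<open>r'\<close> are fixed, \<open>W - S\<close> carries at most one
  edge, so no path of three vertices avoids \<open>S\<close>; with \<open>R = {}\<close> it carries
  none.\<close>

lemma theta_separator_bound:
  assumes th: "theta x y A B C" and W: "W = theta_verts x y A B C"
    and S: "S \<subseteq> W" "x \<in> S" "finite R"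
    and att: "\<And>c z. c \<in> W - S \<Longrightarrow> E c z \<Longrightarrow> z \<in> W"
    and iso: "\<And>s z z'. s \<in> S \<Longrightarrow> E s z \<Longrightarrow> z \<notin> W \<Longrightarrow> E z z' \<Longrightarrow> z' \<in> W"
    and inner: "\<And>a b. a \<in> W - S \<Longrightarrow> b \<in> W - S \<Longrightarrow> E a b \<Longrightarrow> r \<in> R \<and> {a, b} = {r, r'}"
  shows "t \<le> 2 * card S + card R"
proof -
  have WV: "W \<subseteq> V" "x \<in> W" using theta_verts_V[OF th] S by (auto simp: W)
  have ind: "z \<in> W \<or> z' \<in> W" if "E z z'" for z z'
    using outside_independent[of W z z'] iso att that WV by blast
  have both: "a \<in> W \<and> b \<in> W" if "E a b" "a \<notin> S" "b \<notin> S" for a b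
    using ind[OF that(1)] att that sym by blast
  have inner': "r \<in> R \<and> {a, b} = {r, r'}" if "E a b" "a \<notin> S" "b \<notin> S" for a b
    using inner[of a b] both[OF that] that by simp
  show ?thesis
  proof (rule almost_independent_bound)
    show "x \<in> S" "x \<in> V" "finite R" using S WV by auto
    show "finite S" by (rule finite_subset[OF _ fin]) (use S(1) WV(1) in simp)
    show "a \<in> S \<or> b \<in> S \<or> a \<in> R \<or> b \<in> R" if "E a b" for a b
    proof (rule ccontr)
      assume n: "\<not> ?thesis"
      then have "r \<in> R" "r \<in> {a, b}" using inner'[OF that] by auto
      then show False using n by blast
    qed
    show "a \<in> S \<or> b \<in> S \<or> c \<in> S" if "E a b" "E b c" "a \<noteq> c" for a b c
    proof (rule ccontr)
      assume n: "\<not> ?thesis"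
      then have "{a, b} = {b, c}" using inner'[OF that(1)] inner'[OF that(2)] by simp
      then show False using that(3) by (metis doubleton_eq_iff)
    qed
  qed
qed

section \<open>Excluding each triple of branch lengths\<close>

text \<open>In the names below, the numbers are the lengths of the three branches.\<close>

lemma theta_1_1:
  assumes th: "theta x y [u] [v] C"
    and u: "\<And>z. E u z \<Longrightarrow> z \<in> {x, y}" and v: "\<And>z. E v z \<Longrightarrow> z \<in> {x, y}"
  shows False
proof -
  have V: "x \<in> V" "y \<in> V" "u \<in> V" "v \<in> V" "set C \<subseteq> V"
    using theta_verts_V[OF th] by (auto simp: theta_verts_def)
  have d: "distinct (x # y # u # v # C)" and C: "C \<noteq> []" using th by (auto simp: theta_iff)
  \<comment> \<open>The three parts are \<open>{u}\<close>, \<open>{v}\<close> and everything else,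
    which contains \<open>C\<close>.\<close>
  have "closed_mod {x, y} {u}" "closed_mod {x, y} {v}" using u v d V by (auto simp: closed_mod_def)
  moreover have "closed_mod {x, y} (V - {x, y, u, v})"
    unfolding closed_mod_def using u v d V E_in(2) sym by blast
  moreover have "V - {x, y, u, v} \<noteq> {}" using V C d by (cases C) auto
  ultimately show False using no_three_parts[of x y "{u}" "{v}" "V - {x, y, u, v}"] V d by auto
qed

text \<open>Every vertex of \<open>C\<close> is an end of \<open>C\<close>, so
  \<open>theta_single_nbr\<close> leaves only \<open>x\<close> and \<open>y\<close>.\<close>

lemma theta_1_1_le2:
  assumes th: "theta x y [u] [v] C" and le: "length C \<le> 2"
  shows False
proof (rule theta_1_1[OF th])
  have C: "set C \<subseteq> {hd C, last C}"
    using le th by (auto simp: theta_iff length_Suc_conv le_Suc_eq numeral_2_eq_2)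
  show "z \<in> {x, y}" if "E u z" for z using theta_single_nbr[OF th that] C by auto
  show "z \<in> {x, y}" if "E v z" for z using theta_single_nbr[OF theta_swap12[OF th] that] C by auto
qed

text \<open>The third part is what lies outside the theta graph, nonempty by
  nontraceability.\<close>

lemma theta_outside_parts:
  assumes th: "theta x y A B C"
    and D: "closed_mod {x, y} D1" "closed_mod {x, y} D2" "D1 \<noteq> {}" "D2 \<noteq> {}" "D1 \<inter> D2 = {}"
    and sub: "D1 \<subseteq> theta_verts x y A B C" "D2 \<subseteq> theta_verts x y A B C"
    and att: "\<And>c z. c \<in> theta_verts x y A B C - {x, y} \<Longrightarrow> E c z \<Longrightarrow> z \<in> theta_verts x y A B C"
  shows False
proof -
  have "closed_mod {x, y} (V - theta_verts x y A B C)"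
    by (rule theta_outside_closed[OF att]) (auto simp: theta_verts_def)
  then show False
    using no_three_parts[of x y D1 D2 "V - theta_verts x y A B C"] D sub theta_outside[OF th]
      theta_verts_V[OF th] by (auto simp: theta_verts_def)
qed

text \<open>Each inner vertex is an end of its branch and so has no neighbour outside. The parts are
  \<open>{u}\<close>, the other four inner vertices, and the outside.\<close>

lemma theta_1_2_2:
  assumes th: "theta x y [u] [p, q] [r, s]"
  shows False
proof (rule theta_outside_parts[OF th])
  let ?W = "theta_verts x y [u] [p, q] [r, s]"
  have u: "E u z \<Longrightarrow> z \<in> {x, y}" for z using theta_single_nbr[OF th] by auto
  have pq: "z \<in> ?W" if "E p z \<or> E q z" for z
    using theta_hd_nbr[OF theta_swap12[OF th], of z] theta_last_nbr[OF theta_swap12[OF th], of z] that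
    by (auto simp: theta_verts_def)
  have rs: "z \<in> ?W" if "E r z \<or> E s z" for z
    using theta_hd_nbr[OF theta_swap12[OF theta_swap23[OF th]], of z]
      theta_last_nbr[OF theta_swap12[OF theta_swap23[OF th]], of z] that
    by (auto simp: theta_verts_def)
  have V: "?W \<subseteq> V" using theta_verts_V[OF th] .
  have d: "distinct [x, y, u, p, q, r, s]" using th by (simp add: theta_iff)
  show "closed_mod {x, y} {u}" using u V d by (auto simp: closed_mod_def theta_verts_def)
  show "z \<in> ?W" if "c \<in> ?W - {x, y}" "E c z" for c z
  proof -
    have "c \<in> {u, p, q, r, s}" using that(1) by (auto simp: theta_verts_def)
    then show ?thesis using u[of z] pq[of z] rs[of z] that(2) by (auto simp: theta_verts_def)
  qed
  then have "closed_mod {x, y} (?W - {x, y, u})"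
    using u V sym unfolding closed_mod_def by blast
  moreover have "?W - {x, y, u} = {p, q, r, s}" using d by (auto simp: theta_verts_def)
  ultimately show "closed_mod {x, y} {p, q, r, s}" by simp
qed (use th in \<open>auto simp: theta_iff theta_verts_def\<close>)

lemma theta_2_2_2:
  assumes th: "theta x y [p, q] [r, s] [a, b]"
  shows False
proof -
  let ?W = "theta_verts x y [p, q] [r, s] [a, b]"
  have V: "?W \<subseteq> V" using theta_verts_V[OF th] .
  have d: "distinct [x, y, p, q, r, s, a, b]" using th by (simp add: theta_iff)
  have near: "z \<in> theta_verts x y A B C"
    if "theta x y A B C" "E (hd A) z \<or> E (last A) z" for A B C z
    using theta_hd_nbr theta_last_nbr that by blast
  have pq: "z \<in> ?W" if "E p z \<or> E q z" for z
    using near[OF th, of z] that by auto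
  have rs: "z \<in> ?W" if "E r z \<or> E s z" for z
    using near[OF theta_swap12[OF th], of z] that by (auto simp: theta_verts_def)
  have ab: "z \<in> ?W" if "E a z \<or> E b z" for z
    using near[OF theta_swap12[OF theta_swap23[OF th]], of z] that by (auto simp: theta_verts_def)
  have att: "z \<in> ?W" if "c \<in> ?W - {x, y}" "E c z" for c z
  proof -
    have "c \<in> {p, q, r, s, a, b}" using that(1) by (auto simp: theta_verts_def)
    then show ?thesis using ab[of z] pq[of z] rs[of z] that(2) by auto
  qed
  have out: "closed_mod {x, y} (V - ?W)"
    by (rule theta_outside_closed[OF att]) (auto simp: theta_verts_def)
  have ne: "V - ?W \<noteq> {}" using theta_outside[OF th] by blast
  have "E x p" "E q y" using th by (auto simp: theta_iff)
  \<comment> \<open>The outside can only be attached at \<open>x\<close> and \<open>y\<close>, so it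
    is attached to both.\<close>
  then obtain z z' where z: "E x z" "z \<notin> ?W" and z': "E y z'" "z' \<notin> ?W"
    using closed_mod_attached[OF out ne, of q]
      closed_mod_attached[OF out[unfolded closed_mod_swap[of x y]] ne, of p] V sym
    by (auto simp: theta_verts_def)
  \<comment> \<open>Edges between two branches on the side of \<open>x\<close> are excluded by
    \<open>z\<close>, on the side of \<open>y\<close> by \<open>z'\<close>; the mixed ones would
    close a spanning cycle.\<close>
  have cross: "\<not> E c e"
    if th': "theta x y [p', q'] [r', s'] C" "theta_verts x y [p', q'] [r', s'] C = ?W"
      "c \<in> {p', q'}" "e \<in> {r', s'}" for p' q' r' s' C c e
  proof -
    have "\<not> E p' r'" using theta_not_hd_hd[OF th'(1) z(1)] z(2) th'(2) by simp
    moreover have "theta_verts y x [q', p'] [s', r'] (rev C) = ?W"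
      using th'(2) by (auto simp: theta_verts_def)
    then have "\<not> E q' s'" using theta_not_hd_hd[OF theta_rev[OF th'(1)] z'(1)] z'(2) by simp
    moreover have "\<not> E s' p'" using theta_not_last_hd[OF theta_swap23[OF th'(1)]] by simp
    moreover have "\<not> E q' r'"
      using theta_not_last_hd[OF theta_swap23[OF theta_swap12[OF th'(1)]]] by simp
    ultimately show ?thesis using that(3,4) sym by blast
  qed
  have 1: "\<not> E c e" if "c \<in> {p, q}" "e \<in> {r, s}" for c e
    using cross[OF th] that by (auto simp: theta_verts_def)
  have 2: "\<not> E c e" if "c \<in> {p, q}" "e \<in> {a, b}" for c e
    using cross[OF theta_swap23[OF th]] that by (auto simp: theta_verts_def)
  have 3: "\<not> E c e" if "c \<in> {r, s}" "e \<in> {a, b}" for c e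
    using cross[OF theta_swap23[OF theta_swap12[OF th]]] that by (auto simp: theta_verts_def)
  have W: "?W = {x, y, p, q, r, s, a, b}" by (auto simp: theta_verts_def)
  have "w \<in> {x, y, p, q}" if "E p w \<or> E q w" for w
    using pq[OF that] that 1[of p w] 1[of q w] 2[of p w] 2[of q w] unfolding W by blast
  then have "closed_mod {x, y} {p, q}"
    using d V unfolding closed_mod_def W by auto
  moreover have "w \<in> {x, y, r, s}" if "E r w \<or> E s w" for w
    using rs[OF that] that 1[of w r] 1[of w s] 3[of r w] 3[of s w] sym unfolding W by blast
  then have "closed_mod {x, y} {r, s}"
    using d V unfolding closed_mod_def W by auto
  ultimately show False
    by (rule theta_outside_parts[OF th _ _ _ _ _ _ _ att]) (use d in \<open>auto simp: W\<close>)
qed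

text \<open>The chord \<open>u q\<close> makes \<open>{x, y, q}\<close> a set whose deletion leaves
  an independent set, so \<open>t\<close> would be at most 6 instead of 7.\<close>

lemma theta_1_1_3_edge:
  assumes th: "theta x y [u] [v] [p, q, r]" and uq: "E u q"
  shows False
proof -
  let ?W = "theta_verts x y [u] [v] [p, q, r]"
  have W: "?W = {x, y, u, v, p, q, r}" by (auto simp: theta_verts_def)
  have V: "{x, y, u, v, p, q, r} \<subseteq> V" using theta_verts_V[OF th] W by simp
  have d: "distinct [x, y, u, v, p, q, r]" and t: "t = 7"
    and e: "E x u" "E x v" "E x p" "E u y" "E v y" "E r y" "E p q" "E q r"
    using th by (auto simp: theta_iff)
  note e' = e e[THEN sym] uq uq[THEN sym]
  have u: "E u z \<Longrightarrow> z \<in> {x, y, q}" for z using theta_single_nbr[OF th, of z] by auto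
  have v: "E v z \<Longrightarrow> z \<in> {x, y, q}" for z using theta_single_nbr[OF theta_swap12[OF th], of z] by auto
  have th3: "theta x y [p, q, r] [u] [v]" using th by (auto simp: theta_iff)
  have pr: "z \<in> ?W" if "E p z \<or> E r z" for z
    using theta_hd_nbr[OF th3, of z] theta_last_nbr[OF th3, of z] that by (auto simp: theta_verts_def)
  have "path [u, q, p, r, y, v, x]" if "E p r"
    using d V e' that by (auto simp: path_def)
  then have npr: "\<not> E p r" using no_cycle[of "[u, q, p, r, y, v, x]"] t e' by auto
  have "t \<le> 2 * card {x, y, q} + card ({} :: 'a set)"
  proof (rule theta_separator_bound[OF th refl])
    fix c z assume "c \<in> ?W - {x, y, q}" "E c z"
    then show "z \<in> ?W" using u[of z] v[of z] pr[of z] by (auto simp: W)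
  next
    fix s z z' assume s: "s \<in> {x, y, q}" and z: "E s z" "z \<notin> ?W" "E z z'"
    have i: "z' \<in> ?W" if "theta b c B C [a]" "theta_verts b c B C [a] = ?W" "E b z" for a b c B C
      using theta_outside_isolated[OF that(1) _ that(3), of z'] that(2) z by simp
    \<comment> \<open>The same vertices carry theta graphs starting at \<open>x\<close>,
      \<open>y\<close> and \<open>q\<close> whose third branch is a single vertex, so
      \<open>theta_outside_isolated\<close> covers all of \<open>S\<close>.\<close>
    have 1: "theta x y [v] [p, q, r] [u]" "theta y x [v] [r, q, p] [u]" "theta q x [u] [r, y, v] [p]"
      unfolding theta_iff using d t e' by auto
    show "z' \<in> ?W"
      using s z(1) i[OF 1(1)] i[OF 1(2)] i[OF 1(3)] by (auto simp: theta_verts_def)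
  next
    fix a b assume "a \<in> ?W - {x, y, q}" "b \<in> ?W - {x, y, q}" "E a b"
    \<comment> \<open>The goal is plain falsity: no edge remains, so \<open>r\<close> and
      \<open>r'\<close> are arbitrary.\<close>
    then show "x \<in> {} \<and> {a, b} = {x, x}"
      using u[of a] u[of b] v[of a] v[of b] npr d irrefl sym unfolding W by blast
  qed (auto simp: W)
  then show False using t d by simp
qed

lemma theta_1_1_3:
  assumes th: "theta x y [u] [v] [p, q, r]"
  shows False
proof (rule theta_1_1[OF th])
  note th' = theta_swap12[OF th]
  show "z \<in> {x, y}" if "E u z" for z
    using theta_single_nbr[OF th that] theta_1_1_3_edge[OF th] that by auto
  show "z \<in> {x, y}" if "E v z" for z
    using theta_single_nbr[OF th' that] theta_1_1_3_edge[OF th'] that by auto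
qed

text \<open>Deleting \<open>{x, y, q}\<close> leaves only the edge \<open>r s\<close>, so
  \<open>t\<close> would be at most 7 instead of 8.\<close>

lemma theta_1_1_4_edge:
  assumes th: "theta x y [u] [v] [p, q, r, s]" and uq: "E u q"
  shows False
proof -
  let ?W = "theta_verts x y [u] [v] [p, q, r, s]"
  have W: "?W = {x, y, u, v, p, q, r, s}" by (auto simp: theta_verts_def)
  have V: "{x, y, u, v, p, q, r, s} \<subseteq> V" using theta_verts_V[OF th] W by simp
  have d: "distinct [x, y, u, v, p, q, r, s]" and t: "t = 8"
    and e: "E x u" "E x v" "E x p" "E u y" "E v y" "E s y" "E p q" "E q r" "E r s"
    using th by (auto simp: theta_iff)
  note e' = e e[THEN sym] uq uq[THEN sym]
  have no_cyc: False if "path c" "length c = 8" "E (last c) (hd c)" for c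
    using no_cycle[of c] that t by (cases "c = []") auto
  have "path [u, r, s, y, v, x, p, q]" if "E u r"
    using d V e' that by (auto simp: path_def)
  then have ur: "\<not> E u r" using no_cyc[of "[u, r, s, y, v, x, p, q]"] e' by auto
  have "path [r, v, x, p, q, u, y, s]" if "E r v"
    using d V e' that by (auto simp: path_def)
  then have rv: "\<not> E r v" using no_cyc[of "[r, v, x, p, q, u, y, s]"] e' by auto
  have "path [u, q, p, r, s, y, v, x]" if "E p r"
    using d V e' that by (auto simp: path_def)
  then have pr: "\<not> E p r" using no_cyc[of "[u, q, p, r, s, y, v, x]"] e' by auto
  have "path [p, x, v, y, u, q, r, s]"
    using d V e' by (auto simp: path_def)
  then have sp: "\<not> E s p" using no_cyc[of "[p, x, v, y, u, q, r, s]"] e' by auto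
  have u: "E u z \<Longrightarrow> z \<in> {x, y, q}" for z using theta_single_nbr[OF th, of z] ur by auto
  have v: "z \<in> {x, y, q}" if "E v z" for z
    using theta_single_nbr[OF theta_swap12[OF th] that] rv sym[OF that] by auto
  have th3: "theta x y [p, q, r, s] [u] [v]" using th by (auto simp: theta_iff)
  have ps: "z \<in> ?W" if "E p z \<or> E s z" for z
    using theta_hd_nbr[OF th3, of z] theta_last_nbr[OF th3, of z] that by (auto simp: theta_verts_def)
  \<comment> \<open>Regrouped along the chord \<open>u q\<close>, the same vertices form a theta
    graph in which \<open>r\<close> ends a branch.\<close>
  have th4: "theta x q [v, y, s, r] [p] [u]"
    unfolding theta_iff using d t e' by auto
  have r: "z \<in> ?W" if "E r z" for z
    using theta_last_nbr[OF th4, of z] that by (auto simp: theta_verts_def)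
  have "t \<le> 2 * card {x, y, q} + card {r}"
  proof (rule theta_separator_bound[OF th refl])
    fix c z assume "c \<in> ?W - {x, y, q}" "E c z"
    then show "z \<in> ?W" using u[of z] v[of z] ps[of z] r[of z] by (auto simp: W)
  next
    fix b z z' assume s: "b \<in> {x, y, q}" and z: "E b z" "z \<notin> ?W" "E z z'"
    have i: "z' \<in> ?W" if "theta b c B C [a]" "theta_verts b c B C [a] = ?W" "E b z" for a b c B C
      using theta_outside_isolated[OF that(1) _ that(3), of z'] that(2) z by simp
    have 1: "theta x y [v] [p, q, r, s] [u]" "theta y x [v] [s, r, q, p] [u]"
      "theta q x [u] [r, s, y, v] [p]"
      unfolding theta_iff using d t e' by auto
    show "z' \<in> ?W"
      using s z(1) i[OF 1(1)] i[OF 1(2)] i[OF 1(3)] by (auto simp: theta_verts_def)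
  next
    fix a b assume "a \<in> ?W - {x, y, q}" "b \<in> ?W - {x, y, q}" and ab: "E a b"
    then have "a \<in> {u, v, p, r, s}" "b \<in> {u, v, p, r, s}" by (auto simp: W)
    then have "a \<in> {p, r, s}" "b \<in> {p, r, s}"
      using u[of a] u[of b] v[of a] v[of b] ab sym[OF ab] d by auto
    then show "r \<in> {r} \<and> {a, b} = {r, s}"
      using pr sp ab sym[OF ab] irrefl by auto
  qed (auto simp: W)
  then show False using t d by simp
qed

text \<open>An edge from \<open>u\<close> to \<open>r\<close> is the chord of
  \<open>theta_1_1_4_edge\<close> in the reversed theta graph.\<close>

lemma theta_1_1_4:
  assumes th: "theta x y [u] [v] [p, q, r, s]"
  shows False
proof (rule theta_1_1[OF th])
  note th' = theta_swap12[OF th]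
  show "z \<in> {x, y}" if "E u z" for z
    using theta_single_nbr[OF th that] theta_1_1_4_edge[OF th]
      theta_1_1_4_edge[of y x u v s r q p] theta_rev[OF th] that by auto
  show "z \<in> {x, y}" if "E v z" for z
    using theta_single_nbr[OF th' that] theta_1_1_4_edge[OF th']
      theta_1_1_4_edge[of y x v u s r q p] theta_rev[OF th'] that by auto
qed

text \<open>A chord \<open>s u\<close> and an outer neighbour of \<open>s\<close> are treated
  together. In both cases deleting \<open>{x, y, s}\<close> leaves only the edge \<open>p q\<close>,
  so \<open>t\<close> would be at most 7.\<close>

lemma theta_1_2_3_edge:
  assumes th: "theta x y [u] [p, q] [r, s, w]"
    and sm: "E s m" "m = u \<or> m \<notin> theta_verts x y [u] [p, q] [r, s, w]"
  shows False
proof -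
  let ?W = "theta_verts x y [u] [p, q] [r, s, w]"
  have W: "?W = {x, y, u, p, q, r, s, w}" by (auto simp: theta_verts_def)
  have V: "{x, y, u, p, q, r, s, w} \<subseteq> V" using theta_verts_V[OF th] W by simp
  have d: "distinct [x, y, u, p, q, r, s, w]" and t: "t = 8"
    and e: "E x u" "E x p" "E x r" "E u y" "E q y" "E w y" "E p q" "E r s" "E s w"
    using th by (auto simp: theta_iff)
  note e' = e e[THEN sym]
  \<comment> \<open>A spanning path of the theta graph from \<open>s\<close> to \<open>u\<close> is
    closed to a cycle by \<open>m = u\<close>, and extended at \<open>s\<close> by \<open>m\<close>
    outside.\<close>
  have no_ham: False if "path c" "set c = ?W" "length c = 8" "hd c = s" "last c = u" for c
    using no_cycle[of c] hd_nbr[of c m] that t sm sym[OF sm(1)] by (cases "c = []") auto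
  have "path [s, w, y, q, p, r, x, u]" if "E p r"
    using d V e' that by (auto simp: path_def)
  then have pr: "\<not> E p r" using no_ham[of "[s, w, y, q, p, r, x, u]"] by (auto simp: W)
  have "path [s, r, x, p, q, w, y, u]" if "E q w"
    using d V e' that by (auto simp: path_def)
  then have qw: "\<not> E q w" using no_ham[of "[s, r, x, p, q, w, y, u]"] by (auto simp: W)
  have "path [s, r, w, y, q, p, x, u]" if "E r w"
    using d V e' that by (auto simp: path_def)
  then have rw: "\<not> E r w" using no_ham[of "[s, r, w, y, q, p, x, u]"] by (auto simp: W)
  have th2: "theta x y [p, q] [r, s, w] [u]" "theta x y [r, s, w] [p, q] [u]"
    using th by (auto simp: theta_iff)
  have wp: "\<not> E w p"
    using theta_not_last_hd[OF theta_swap23[OF th2(1)]] by simp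
  have qr: "\<not> E q r"
    using theta_not_last_hd[OF theta_swap23[OF th2(2)]] by simp
  have u: "E u z \<Longrightarrow> z \<in> {x, y, s}" for z using theta_single_nbr[OF th, of z] by auto
  have near: "z \<in> ?W" if "E p z \<or> E q z \<or> E r z \<or> E w z" for z
    using theta_hd_nbr[OF th2(1), of z] theta_last_nbr[OF th2(1), of z]
      theta_hd_nbr[OF th2(2), of z] theta_last_nbr[OF th2(2), of z] that
    by (auto simp: theta_verts_def)
  have "t \<le> 2 * card {x, y, s} + card {p}"
  proof (rule theta_separator_bound[OF th refl])
    fix c z assume "c \<in> ?W - {x, y, s}" "E c z"
    then show "z \<in> ?W" using u[of z] near[of z] by (auto simp: W)
  next
    fix b z z' assume b: "b \<in> {x, y, s}" and z: "E b z" "z \<notin> ?W" "E z z'"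
    have i: "z' \<in> ?W" if "theta b c B C [a]" "theta_verts b c B C [a] = ?W" "E b z" for a b c B C
      using theta_outside_isolated[OF that(1) _ that(3), of z'] that(2) z by simp
    have 1: "theta y x [q, p] [w, s, r] [u]"
      unfolding theta_iff using d t e' by auto
    have "z' \<in> ?W" if "b = s"
    proof (rule ccontr)
      assume n: "z' \<notin> ?W"
      then have "path [z', z, s, r, x, p, q, y, u]"
        using d V e' z that sym[OF z(1)] sym[OF z(3)] E_in[OF z(3)] irrefl[of z]
        by (auto simp: path_def W)
      then show False using path_length t by fastforce
    qed
    then show "z' \<in> ?W"
      using b z(1) i[OF th2(1)] i[OF 1(1)] by (auto simp: theta_verts_def)
  next
    fix a b assume "a \<in> ?W - {x, y, s}" "b \<in> ?W - {x, y, s}" and ab: "E a b"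
    then have "a \<in> {u, p, q, r, w}" "b \<in> {u, p, q, r, w}" by (auto simp: W)
    then have "a \<in> {p, q, r, w}" "b \<in> {p, q, r, w}"
      using u[of a] u[of b] ab sym[OF ab] d by auto
    then show "p \<in> {p} \<and> {a, b} = {p, q}"
      using pr qw rw wp qr ab sym[OF ab] irrefl by auto
  qed (auto simp: W)
  then show False using t d by simp
qed

lemma theta_1_2_3:
  assumes th: "theta x y [u] [p, q] [r, s, w]"
  shows False
proof (rule theta_outside_parts[OF th])
  let ?W = "theta_verts x y [u] [p, q] [r, s, w]"
  have W: "?W = {x, y, u, p, q, r, s, w}" by (auto simp: theta_verts_def)
  have d: "distinct [x, y, u, p, q, r, s, w]" using th by (auto simp: theta_iff)
  have V: "{x, y, u, p, q, r, s, w} \<subseteq> V" using theta_verts_V[OF th] W by simp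
  have u: "z \<in> {x, y}" if "E u z" for z
    using theta_single_nbr[OF th that] theta_1_2_3_edge[OF th, of u] sym[OF that] by auto
  have th2: "theta x y [p, q] [r, s, w] [u]" "theta x y [r, s, w] [p, q] [u]"
    using th by (auto simp: theta_iff)
  have near: "z \<in> ?W" if "E p z \<or> E q z \<or> E r z \<or> E s z \<or> E w z" for z
    using theta_hd_nbr[OF th2(1), of z] theta_last_nbr[OF th2(1), of z]
      theta_hd_nbr[OF th2(2), of z] theta_last_nbr[OF th2(2), of z] theta_1_2_3_edge[OF th, of z] that
    by (auto simp: theta_verts_def)
  show "closed_mod {x, y} {u}" using u V d by (auto simp: closed_mod_def)
  show att: "z \<in> ?W" if "c \<in> ?W - {x, y}" "E c z" for c z
    using that u[of z] near[of z] by (auto simp: W)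
  have "z \<in> ?W - {u}" if "c \<in> ?W - {x, y, u}" "E c z" for c z
    using att[of c z] that u[of c] sym[OF that(2)] by auto
  then have "closed_mod {x, y} (?W - {x, y, u})"
    using theta_verts_V[OF th] unfolding closed_mod_def by blast
  moreover have "?W - {x, y, u} = {p, q, r, s, w}" using d by (auto simp: theta_verts_def)
  ultimately show "closed_mod {x, y} {p, q, r, s, w}" by simp
qed (use th in \<open>auto simp: theta_iff theta_verts_def\<close>)

section \<open>Reduction of all theta graphs to the listed shapes\<close>

lemma no_sorted_theta:
  assumes th: "theta x y A B C" and le: "length A \<le> length B" "length B \<le> length C" and t: "t \<le> 8"
  shows False
proof -
  have "A \<noteq> []" "B \<noteq> []" "length A + length B + length C \<le> 6"
    using th t by (auto simp: theta_iff)
  then have "length A \<ge> 1" "length A + length B + length C \<le> 6"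
    by (simp_all add: Suc_le_eq)
  then have "length A = 1 \<and> length B = 1 \<and> length C \<le> 2 \<or>
      length A = 1 \<and> length B = 1 \<and> length C = 3 \<or>
      length A = 1 \<and> length B = 1 \<and> length C = 4 \<or>
      length A = 1 \<and> length B = 2 \<and> length C = 2 \<or>
      length A = 1 \<and> length B = 2 \<and> length C = 3 \<or>
      length A = 2 \<and> length B = 2 \<and> length C = 2"
    using le by presburger
  then show False
  proof (elim disjE conjE)
    assume "length A = 1" "length B = 1" "length C \<le> 2"
    then show False using th theta_1_1_le2 by (auto simp: length_Suc_conv)
  next
    assume "length A = 1" "length B = 1" "length C = 3"
    then show False using th theta_1_1_3 by (auto simp: length_Suc_conv numeral_eq_Suc)
  next
    assume "length A = 1" "length B = 1" "length C = 4"
    then show False using th theta_1_1_4 by (auto simp: length_Suc_conv numeral_eq_Suc)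
  next
    assume "length A = 1" "length B = 2" "length C = 2"
    then show False using th theta_1_2_2 by (auto simp: length_Suc_conv numeral_eq_Suc)
  next
    assume "length A = 1" "length B = 2" "length C = 3"
    then show False using th theta_1_2_3 by (auto simp: length_Suc_conv numeral_eq_Suc)
  next
    assume "length A = 2" "length B = 2" "length C = 2"
    then show False using th theta_2_2_2 by (auto simp: length_Suc_conv numeral_eq_Suc)
  qed
qed

lemma no_theta:
  assumes th: "theta x y A B C" and t: "t \<le> 8"
  shows False
proof -
  note s12 = theta_swap12 and s23 = theta_swap23
  consider "length A \<le> length B" "length B \<le> length C" | "length A \<le> length C" "length C \<le> length B"
    | "length B \<le> length A" "length A \<le> length C" | "length B \<le> length C" "length C \<le> length A"
    | "length C \<le> length A" "length A \<le> length B" | "length C \<le> length B" "length B \<le> length A"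
    by linarith
  then show False
    by cases (use no_sorted_theta[OF th] no_sorted_theta[OF s23[OF th]] no_sorted_theta[OF s12[OF th]]
        no_sorted_theta[OF s23[OF s12[OF th]]] no_sorted_theta[OF s12[OF s23[OF th]]]
        no_sorted_theta[OF s12[OF s23[OF s12[OF th]]]] t in simp_all)
qed

section \<open>Neighbours of the two ends of a longest path\<close>

text \<open>Positions count from 0, so the last vertex is at \<open>t - 1\<close>.\<close>

definition end_nbrs :: "'a list \<Rightarrow> nat \<Rightarrow> nat \<Rightarrow> bool" where
  "end_nbrs p i j \<longleftrightarrow> path p \<and> length p = t \<and> i < t \<and> j < t \<and> E (p ! 0) (p ! i) \<and> E (p ! (t - 1)) (p ! j)"

text \<open>If \<open>j < i\<close>, the path and its two extra edges form a theta graph with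
  branching vertices \<open>p ! j\<close> and \<open>p ! i\<close>; if these are consecutive on the
  path, they form a spanning cycle instead.\<close>

lemma end_nbrs_le:
  assumes c: "end_nbrs p i j" and t: "t \<le> 8"
  shows "i \<le> j"
proof (rule ccontr)
  assume "\<not> i \<le> j"
  then have ji: "j < i" by simp
  have p: "path p" "length p = t" "i < t" "j < t" "E (p ! 0) (p ! i)" "E (p ! (t - 1)) (p ! j)"
    using c by (auto simp: end_nbrs_def)
  define us ms ws where "us = take j p" and "ms = take (i - Suc j) (drop (Suc j) p)"
    and "ws = drop (Suc i) p"
  define x y where "x = p ! j" and "y = p ! i"
  have "drop (Suc j) p = ms @ y # ws"
    using ji p id_take_nth_drop[of "i - Suc j" "drop (Suc j) p"]
    by (simp add: ms_def ws_def y_def)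
  then have pd: "p = us @ x # ms @ y # ws"
    using id_take_nth_drop[of j p] p by (simp add: us_def x_def)
  have ne: "p \<noteq> []" using pd by simp
  have hl: "E (hd p) y" "E (last p) x"
    using p ne by (simp_all add: hd_conv_nth last_conv_nth x_def y_def)
  have nc: "\<not> E (last p) (hd p)" using no_cycle p ne by blast
  \<comment> \<open>An empty \<open>us\<close> or \<open>ws\<close> would make the two ends of
    \<open>p\<close> adjacent.\<close>
  have us: "us \<noteq> []" using nc hl(2) pd by (cases us) auto
  have ws: "ws \<noteq> []" using nc sym[OF hl(1)] pd by (cases ws) auto
  have hl': "E (hd us) y" "E (last ws) x" using hl us ws pd by simp_all
  have s: "distinct p" "successively E p" "set p \<subseteq> V" using p by (auto simp: path_def)
  show False
  proof (cases "ms = []")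
    case True
    have "path (us @ x # rev (y # ws))"
      using s hl' us ws True
      by (auto simp: pd path_def successively_append_iff successively_Cons successively_E_flip
          hd_rev last_rev E_commute)
    moreover have "E (last (us @ x # rev (y # ws))) (hd (us @ x # rev (y # ws)))"
      using hl' us sym by simp
    ultimately show False
      using no_cycle[of "us @ x # rev (y # ws)"] p(2) pd True by simp
  next
    case False
    have "theta x y ms (rev us) (rev ws)"
      using s hl' us ws False p(2)
      by (auto simp: pd theta_iff successively_append_iff successively_Cons successively_E_flip
          hd_rev last_rev E_commute)
    then show False using no_theta t by blast
  qed
qed

lemma end_nbrs_rev:
  assumes "end_nbrs p i j"
  shows "end_nbrs (rev p) (t - 1 - j) (t - 1 - i)"
  using assms by (auto simp: end_nbrs_def path_rev rev_nth)

text \<open>Rearranging the at most three vertices \<open>vs\<close> after \<open>p ! j\<close>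
  produces other possible last vertices. Minimality keeps their neighbours within \<open>x\<close>
  and the tail, which gives a cut vertex or three parts.\<close>

lemma end_nbrs_short_tail:
  assumes c: "end_nbrs p i j" and t: "t \<le> 8"
    and least: "\<And>p' i' j'. end_nbrs p' i' j' \<Longrightarrow> j - i \<le> j' - i'"
    and tail: "t \<le> j + 4"
  shows False
proof -
  have p: "path p" "length p = t" "i < t" "j < t" "E (p ! 0) (p ! i)" "E (p ! (t - 1)) (p ! j)"
    using c by (auto simp: end_nbrs_def)
  have ij: "i \<le> j" using end_nbrs_le c t by blast
  define ps x vs where "ps = take j p" and "x = p ! j" and "vs = drop (Suc j) p"
  have pd: "p = ps @ x # vs" and lps: "length ps = j"
    using id_take_nth_drop[of j p] p by (simp_all add: ps_def x_def vs_def)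
  have "i > 0" using p(5) irrefl by (cases i) auto
  then have ps: "ps \<noteq> []" using lps ij by auto
  have "t - 1 \<noteq> j" using p(6) irrefl by metis
  then have vs: "vs \<noteq> []" "length vs \<le> 3" "length vs = t - Suc j"
    using p tail by (auto simp: vs_def)
  have "last p = p ! (t - 1)" using last_conv_nth[of p] pd p(2) by blast
  moreover have "last p = last vs" using pd vs(1) by simp
  ultimately have lv: "E (last vs) x" using p(6) x_def by metis
  \<comment> \<open>A neighbour in \<open>ps\<close> at position \<open>k < j\<close> would give
    \<open>end_nbrs\<close> with \<open>i\<close> and \<open>k\<close>. Since \<open>i\<close> is at
    most \<open>k\<close>, the subtraction is not truncated and the gap is really smaller.\<close>
  have nbr: "z \<in> insert x (set vs')"
    if p': "path (ps @ x # vs')" "length vs' = length vs" and z: "E (last vs') z" for vs' z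
  proof (rule ccontr)
    assume n: "z \<notin> insert x (set vs')"
    let ?p = "ps @ x # vs'"
    have v': "vs' \<noteq> []" using p'(2) vs(1) by auto
    have len: "length ?p = t" using p'(2) p(2) pd by simp
    have "z \<in> set ?p" using last_nbr[of ?p z] p' len z v' by simp
    then have "z \<in> set ps" using n by auto
    then obtain k where k: "k < j" "z = ps ! k" using lps by (auto simp: in_set_conv_nth)
    have "?p ! 0 = p ! 0" "?p ! i = p ! i" using ij ps lps by (auto simp: pd nth_append)
    moreover have "?p ! (t - 1) = last vs'" "?p ! k = z"
      using last_conv_nth[of ?p] len v' k lps by (auto simp: nth_append)
    ultimately have "end_nbrs ?p i k"
      unfolding end_nbrs_def using p p'(1) len k(1) z by auto
    then have "i \<le> k" "j - i \<le> k - i" using end_nbrs_le t least by blast+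
    then show False using k(1) by linarith
  qed
  have s: "path (ps @ x # vs)" using p(1) pd by simp
  have psx: "E (last ps) x" using s ps by (simp add: path_def successively_append_iff)
  have xps: "E x (last ps)" "last ps \<in> set ps" using sym[OF psx] ps by simp_all
  have V: "set ps \<subseteq> V" "x \<in> V" "set vs \<subseteq> V" and d: "distinct (x # vs)" "set ps \<inter> set (x # vs) = {}"
    using s by (auto simp: path_def)
  have lp: "last ps \<notin> set (x # vs)" using xps d by blast
  have cut: False if "closed_mod {x} (set vs)"
    using no_cut_vertex[OF that, of "last vs" "last ps"] sym[OF lv] xps lp vs(1) by auto
  consider a where "vs = [a]" | a b where "vs = [a, b]" | a b e where "vs = [a, b, e]"
    using vs(1,2) by (cases vs; cases "tl vs"; cases "tl (tl vs)") auto
  then show False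
  proof cases
    case (1 a)
    then show False using cut nbr[OF s] V d by (auto simp: closed_mod_def)
  next
    case (2 a b)
    \<comment> \<open>The edge from \<open>x\<close> to the last vertex allows the tail to be
      reversed.\<close>
    have "path (ps @ x # [b, a])"
      using s lv 2 by (auto simp: path_def successively_append_iff E_commute)
    then have "\<And>z. E a z \<Longrightarrow> z \<in> {x, a, b}" using nbr[of "[b, a]"] 2 by auto
    then show False using cut nbr[OF s] V d 2 by (auto simp: closed_mod_def)
  next
    case (3 a b e)
    have Ne: "z \<in> {x, a, b, e}" if "E e z" for z using nbr[OF s] that 3 by auto
    have "path (ps @ x # [e, b, a])"
      using s lv 3 by (auto simp: path_def successively_append_iff E_commute)
    then have Na: "z \<in> {x, a, b, e}" if "E a z" for z using nbr[of "[e, b, a]"] that 3 by auto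
    show False
    proof (cases "E a e")
      case True
      \<comment> \<open>The triangle on the tail lets \<open>b\<close> be last too, so
        \<open>x\<close> separates the whole tail.\<close>
      then have "path (ps @ x # [a, e, b])"
        using s 3 by (auto simp: path_def successively_append_iff E_commute)
      then have "\<And>z. E b z \<Longrightarrow> z \<in> {x, a, b, e}" using nbr[of "[a, e, b]"] 3 by auto
      then show False using cut Ne Na V d 3 by (auto simp: closed_mod_def)
    next
      case False
      \<comment> \<open>Without the edge \<open>a e\<close>, deleting \<open>x\<close> and
        \<open>b\<close> isolates both \<open>a\<close> and \<open>e\<close> from the rest, which
        contains \<open>last ps\<close>.\<close>
      have Na': "E a z \<Longrightarrow> z \<in> {x, b}" and Ne': "E e z \<Longrightarrow> z \<in> {x, b}" for z
        using Na[of z] Ne[of z] False sym[of e a] irrefl by blast+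
      have "closed_mod {x, b} {a}" "closed_mod {x, b} {e}"
        using Na' Ne' V d 3 by (auto simp: closed_mod_def)
      moreover have "closed_mod {x, b} (V - {x, b, a, e})"
        unfolding closed_mod_def using Na' Ne' E_in(2) sym by blast
      moreover have "last ps \<in> V - {x, b, a, e}" using lp 3 xps V by auto
      then have "V - {x, b, a, e} \<noteq> {}" by blast
      ultimately show False
        using no_three_parts[of x b "{a}" "{e}" "V - {x, b, a, e}"] V d 3 by auto
    qed
  qed
qed

lemma nine_le: "9 \<le> t"
proof (rule ccontr)
  assume "\<not> 9 \<le> t"
  then have t: "t \<le> 8" by simp
  obtain v where v: "v \<in> V" using nonempty by blast
  have "{v} \<noteq> V" using nontraceable[of "[v]"] by simp
  then obtain w where "E v w" "w \<noteq> v" using conn[of "{v}"] v by blast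
  then have "2 \<le> t" using path_length[of "[v, w]"] E_in[of v w] by (auto simp: path_def)
  obtain q where q: "path (v # q)" "length (v # q) = t" using start_path v by metis
  let ?p = "v # q"
  have suc: "E (?p ! i) (?p ! Suc i)" if "Suc i < t" for i
    using successively_nth[of E ?p i] q that by (simp add: path_def)
  \<comment> \<open>The path neighbours of the two ends always qualify, so a minimal choice
    exists.\<close>
  have "end_nbrs ?p 1 (t - 2)"
    unfolding end_nbrs_def using q suc[of 0] suc[of "t - 2"] \<open>2 \<le> t\<close>
    by (auto simp: E_commute Suc_diff_Suc numeral_2_eq_2)
  then obtain p i j where c: "end_nbrs p i j"
    and least: "\<And>p' i' j'. end_nbrs p' i' j' \<Longrightarrow> j - i \<le> j' - i'"
    using ex_has_least_nat[of "\<lambda>(p, i, j). end_nbrs p i j" "(?p, 1, t - 2)" "\<lambda>(p, i, j). j - i"]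
    by (auto 4 4)
  have ij: "i < t" "j < t" "i \<le> j" using c end_nbrs_le t by (auto simp: end_nbrs_def)
  show False
  proof (cases "t \<le> j + 4")
    case True
    then show False using end_nbrs_short_tail c least t by blast
  next
    case False
    \<comment> \<open>Here \<open>j\<close> is at most 3, hence so is \<open>i\<close>: the part
      before \<open>p ! i\<close> is short, and reversal preserves the minimal gap.\<close>
    have "(t - 1 - i) - (t - 1 - j) = j - i" "t \<le> (t - 1 - i) + 4" using ij False t by auto
    then show False using end_nbrs_short_tail[OF end_nbrs_rev[OF c] t] least by simp
  qed
qed

end

section \<open>Transfer to the original definitions\<close>

lemma is_path_iff:
  "is_path V E p \<longleftrightarrow> p \<noteq> [] \<and> distinct p \<and> successively E p \<and> set p \<subseteq> V"
  by (auto simp: is_path_def successively_conv_nth)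

theorem theorem2p4:
  fixes V :: "'a set" and E :: "'a \<Rightarrow> 'a \<Rightarrow> bool"
  assumes "simple_graph V E"
    and "connected_graph V E"
    and "\<not> traceable V E"
    and "detour_graph V E"
  shows "tau_graph V E \<ge> 9 \<and> card V \<ge> 10"
proof -
  define t where "t = tau_graph V E"
  have fin: "finite V" and E_in: "\<And>a b. E a b \<Longrightarrow> a \<in> V \<and> b \<in> V"
    and irrefl: "\<And>a. \<not> E a a" and sym: "\<And>a b. E a b \<Longrightarrow> E b a"
    using assms(1) by (auto simp: simple_graph_def)
  have ne: "V \<noteq> {}" using assms(2) by (simp add: connected_graph_def)
  have fin_paths: "finite {p. is_path V E p}"
    by (rule finite_subset[OF _ finite_subset_distinct[OF fin]]) (auto simp: is_path_def)
  have le_t: "length p \<le> t" if "is_path V E p" for p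
    unfolding t_def tau_graph_def using fin_paths that by simp
  have single: "is_path V E [v]" if "v \<in> V" for v using that by (simp add: is_path_def)
  then have "t \<in> length ` {p. is_path V E p}"
    unfolding t_def tau_graph_def using fin_paths ne by (intro Max_in) auto
  then obtain p where p: "is_path V E p" "length p = t" by auto
  let ?P = "\<lambda>v. {p. is_path V E p \<and> (hd p = v \<or> last p = v)}"
  have finP: "finite (?P v)" for v by (rule finite_subset[OF _ fin_paths]) auto
  have hdV: "hd p \<in> V" using p(1) by (auto simp: is_path_def)
  \<comment> \<open>One vertex attains \<open>t\<close>, so by the detour property all do.\<close>
  have "t \<le> tau_vertex V E (hd p)"
    unfolding tau_vertex_def using finP p by (intro Max_ge) auto
  then have tau: "t \<le> tau_vertex V E v" if "v \<in> V" for v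
    using assms(4) that hdV unfolding detour_graph_def by metis
  have starts: "\<exists>p. distinct p \<and> successively E p \<and> set p \<subseteq> V \<and> length p = t \<and> p \<noteq> [] \<and> hd p = v"
    if "v \<in> V" for v
  proof -
    have "tau_vertex V E v \<in> length ` ?P v"
      unfolding tau_vertex_def using finP single[OF that] by (intro Max_in) auto
    then obtain q where q: "is_path V E q" "hd q = v \<or> last q = v" "length q = tau_vertex V E v"
      by auto
    have "length q = t" using le_t[OF q(1)] tau[OF that] q(3) by simp
    moreover have "successively (\<lambda>a b. E b a) q"
      by (rule successively_mono[of E]) (use q(1) sym in \<open>unfold is_path_iff, blast+\<close>)
    then have "is_path V E (rev q)" using q(1) by (simp add: is_path_iff)
    ultimately show ?thesis using q(1,2) hd_rev[of q] length_rev[of q] unfolding is_path_iff by metis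
  qed
  have conn: "D = V"
    if D: "D \<subseteq> V" "D \<noteq> {}" and step: "\<And>d w. d \<in> D \<Longrightarrow> E d w \<Longrightarrow> w \<in> D" for D
  proof -
    have walk: "successively E q \<Longrightarrow> q \<noteq> [] \<Longrightarrow> hd q \<in> D \<Longrightarrow> last q \<in> D" for q
      by (induction q) (auto simp: successively_Cons dest: step)
    obtain d where d: "d \<in> D" using D by blast
    have "v \<in> D" if v: "v \<in> V" for v
    proof -
      obtain q where "is_path V E q" "hd q = d" "last q = v"
        using assms(2) d v D(1) unfolding connected_graph_def by blast
      then show ?thesis using walk[of q] d by (auto simp: is_path_iff)
    qed
    then show ?thesis using D(1) by blast
  qed
  have nontr: "set q \<noteq> V" if "distinct q" "successively E q" for q
    using assms(3) that ne unfolding traceable_def is_path_iff by auto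
  interpret detour V E t
  proof
    show "length q \<le> t" if "distinct q" "successively E q" "set q \<subseteq> V" for q
      using le_t[of q] that by (cases q) (auto simp: is_path_iff)
  qed (use fin E_in irrefl sym starts conn nontr ne in blast)+
  have "9 \<le> t" by (rule nine_le)
  moreover have "set p \<subset> V" "distinct p" using p nontr by (auto simp: is_path_iff)
  \<comment> \<open>A longest path misses a vertex, which turns 9 into 10.\<close>
  then have "t < card V" using psubset_card_mono[OF fin] p(2) distinct_card by metis
  ultimately show ?thesis by (simp add: t_def)
qed

end
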